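(* All Runge-Kutta methods preserve all rational first integrals with affine numerator and denominator. That is, let $Q,R:\mathbb{R}^n\to\mathbb{R}$ be affine functions with $R\not\equiv0$, and suppose that $H(\boldsymbol{x})=Q(\boldsymbol{x})/R(\boldsymbol{x})$ is a first integral of the autonomous ODE $\dot{\boldsymbol{x}}=\boldsymbol{f}(\boldsymbol{x})$. Then the map $\varphi_h$ of any Runge-Kutta method applied to this ODE satisfies $H(\varphi_h(\boldsymbol{x}))=H(\boldsymbol{x})$.
   Context: An $s$-stage Runge-Kutta method with real coefficients $\mathcal{A}=[a_{ij}]\in\mathbb{R}^{s\times s}$, $\boldsymbol{b}\in\mathbb{R}^s$ and time step $h$ applied to $\dot{\boldsymbol{x}}=\boldsymbol{f}(\boldsymbol{x})$ defines the map $\varphi_h$ by $$\boldsymbol{g}_i=\boldsymbol{x}+h\sum_{j=1}^s a_{ij}\boldsymbol{f}(\boldsymbol{g}_j)\quad(i=1,\dots,s),\qquad \varphi_h(\boldsymbol{x})=\boldsymbol{x}+h\sum_{j=1}^s b_j\boldsymbol{f}(\boldsymbol{g}_j).$$ A first integral is a function $H$ with $\boldsymbol{f}(\boldsymbol{x})^T\nabla H(\boldsymbol{x})=0$. Convention: $\boldsymbol{f}$ is continuously differentiable on an open set $U\subseteq\mathbb{R}^n$ on which $R\neq0$, and $H$ is a first integral on $U$; for each $\boldsymbol{x}\in U$, $|h|$ is taken sufficiently small (depending on $\boldsymbol{x}$), and the stages are the solution of the stage equations near $\boldsymbol{x}$ (with $\boldsymbol{g}_i\to\boldsymbol{x}$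 as $h\to0$), so that the stages and $\varphi_h(\boldsymbol{x})$ lie in $U$. *)

theory Defs
  imports "HOL-Analysis.Analysis"
begin

definition affine_function :: "(real ^ 'n \<Rightarrow> real) \<Rightarrow> bool"
  where "affine_function Q \<longleftrightarrow> (\<exists>a c. \<forall>x. Q x = a \<bullet> x + c)"

definition continuously_differentiable_on ::
    "(real ^ 'n \<Rightarrow> real ^ 'n) \<Rightarrow> (real ^ 'n) set \<Rightarrow> bool"
  where "continuously_differentiable_on f U \<longleftrightarrow>
    (\<exists>f' :: real ^ 'n \<Rightarrow> (real ^ 'n) \<Rightarrow>\<^sub>L (real ^ 'n).
      (\<forall>x\<in>U. (f has_derivative blinfun_apply (f' x)) (at x)) \<and> continuous_on U f')"

definition first_integral_on ::
    "(real ^ 'n) set \<Rightarrow> (real ^ 'n \<Rightarrow> real ^ 'n) \<Rightarrow> (real ^ 'n \<Rightarrow> real) \<Rightarrow> bool"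
  where "first_integral_on U f H \<longleftrightarrow> (\<forall>x\<in>U. \<exists>D. GDERIV H x :> D \<and> f x \<bullet> D = 0)"

definition rk_stage_equations ::
    "real ^ 's ^ 's \<Rightarrow> (real ^ 'n \<Rightarrow> real ^ 'n) \<Rightarrow> real \<Rightarrow> real ^ 'n \<Rightarrow> real ^ 'n ^ 's \<Rightarrow> bool"
  where "rk_stage_equations A f h x g \<longleftrightarrow>
    (\<forall>i. g $ i = x + h *\<^sub>R (\<Sum>j\<in>UNIV. (A $ i $ j) *\<^sub>R f (g $ j)))"

definition rk_map ::
    "real ^ 's \<Rightarrow> (real ^ 'n \<Rightarrow> real ^ 'n) \<Rightarrow> (real \<Rightarrow> real ^ 'n ^ 's) \<Rightarrow> real \<Rightarrow> real ^ 'n \<Rightarrow> real ^ 'n"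
  where "rk_map b f G h x = x + h *\<^sub>R (\<Sum>j\<in>UNIV. (b $ j) *\<^sub>R f (G h $ j))"

text \<open>
  The stage equations of an implicit method may have further solutions far away from \<open>x\<close>.
  The stages meant are the ones near \<open>x\<close>: for \<open>\<bar>h\<bar> < h0\<close>, the vector \<open>G h\<close> is the only solution
  with all components in a fixed ball around \<open>x\<close>, and all its components tend to \<open>x\<close> as \<open>h\<close>
  tends to 0. Any two such families agree for all sufficiently small \<open>\<bar>h\<bar>\<close>.
\<close>

definition rk_local_stages ::
    "real ^ 's ^ 's \<Rightarrow> (real ^ 'n \<Rightarrow> real ^ 'n) \<Rightarrow> real ^ 'n \<Rightarrow> real \<Rightarrow> (real \<Rightarrow> real ^ 'n ^ 's) \<Rightarrow> bool"
  where "rk_local_stages A f x h0 G \<longleftrightarrow>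
    (\<exists>\<delta>>0. \<forall>h. \<bar>h\<bar> < h0 \<longrightarrow>
      (\<forall>g. rk_stage_equations A f h x g \<and> (\<forall>i. g $ i \<in> ball x \<delta>) \<longleftrightarrow> g = G h)) \<and>
    (\<forall>i. ((\<lambda>h. G h $ i) \<longlongrightarrow> x) (at 0))"

end

theory Submission
  imports Defs
begin

text \<open>
  Fix \<open>x\<close> and put \<open>\<lambda> = H x\<close>. The affine function \<open>L = Q - \<lambda> R\<close> has constant gradient \<open>l\<close>, and the
  first integral condition says \<open>l \<bullet> f y = \<rho> y * L y\<close> with \<open>\<rho>\<close> continuous, so that \<open>{L = 0}\<close> is
  an invariant hyperplane through \<open>x\<close>. Applying \<open>L\<close> to the stage equations, the values \<open>L (g i)\<close>
  solve a homogeneous linear system that is a small perturbation of the identity, so they vanish.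
  Hence \<open>L\<close> also vanishes at \<open>\<phi>\<^sub>h x\<close>, which means \<open>H (\<phi>\<^sub>h x) = \<lambda>\<close>. The stages themselves come from
  the Banach fixed point theorem.
\<close>

section \<open>Estimates for weighted sums and for C^1 maps on compact sets\<close>

lemma norm_sum_scaleR_le:
  fixes v :: "'i \<Rightarrow> 'a::real_normed_vector"
  assumes "\<And>j. j \<in> J \<Longrightarrow> norm (v j) \<le> m"
  shows "norm (\<Sum>j\<in>J. c j *\<^sub>R v j) \<le> (\<Sum>j\<in>J. \<bar>c j\<bar>) * m"
proof -
  have "norm (\<Sum>j\<in>J. c j *\<^sub>R v j) \<le> (\<Sum>j\<in>J. \<bar>c j\<bar> * m)"
    by (rule sum_norm_le) (simp add: assms mult_left_mono)
  then show ?thesis by (simp add: sum_distrib_right)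
qed

lemma compact_continuous_on_norm_bound:
  fixes f :: "'a::topological_space \<Rightarrow> 'b::real_normed_vector"
  assumes "compact S" "continuous_on S f"
  obtains M where "M > 0" "\<And>y. y \<in> S \<Longrightarrow> norm (f y) \<le> M"
  using compact_imp_bounded[OF compact_continuous_image[OF assms(2,1)]]
  unfolding bounded_pos by auto

lemma continuously_differentiable_on_subset:
  assumes "continuously_differentiable_on f U" "S \<subseteq> U"
  shows "continuously_differentiable_on f S"
  using assms unfolding continuously_differentiable_on_def
  by (meson continuous_on_subset subsetD)

lemma continuously_differentiable_on_imp_continuous_on:
  assumes "continuously_differentiable_on f S"
  shows "continuous_on S f"
  using assms unfolding continuously_differentiable_on_def
  by (metis continuous_at_imp_continuous_on has_derivative_continuous)

text \<open>Mean value inequality: compactness bounds the operator norm of the derivative, and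
  convexity keeps the segment from \<open>y\<close> to \<open>z\<close> inside \<open>S\<close>. The
  constant \<open>K\<close> later makes the stage map a contraction.\<close>

lemma continuously_differentiable_on_lipschitz:
  assumes "continuously_differentiable_on f S" "compact S" "convex S"
  obtains K where "K > 0"
    "\<And>y z. y \<in> S \<Longrightarrow> z \<in> S \<Longrightarrow> norm (f y - f z) \<le> K * norm (y - z)"
proof -
  obtain f' where f': "\<And>y. y \<in> S \<Longrightarrow> (f has_derivative blinfun_apply (f' y)) (at y)"
    and cont: "continuous_on S f'"
    using assms(1) unfolding continuously_differentiable_on_def by blast
  obtain K where "K > 0" and K: "\<And>y. y \<in> S \<Longrightarrow> norm (f' y) \<le> K"
    using compact_continuous_on_norm_bound[OF assms(2) cont] by blast
  have "norm (f y - f z) \<le> K * norm (y - z)" if "y \<in> S" "z \<in> S" for y z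
    by (rule differentiable_bound[OF assms(3) _ _ that, where f' = "\<lambda>y. blinfun_apply (f' y)"])
      (auto intro: has_derivative_at_withinI f' simp: norm_blinfun.rep_eq[symmetric] K)
  with \<open>K > 0\<close> show ?thesis by (rule that)
qed

section \<open>Sums weighted by the coefficient matrix\<close>

definition abs_sum :: "real ^ 's ^ 's \<Rightarrow> real"
  where "abs_sum A = (\<Sum>i\<in>UNIV. \<Sum>j\<in>UNIV. \<bar>A $ i $ j\<bar>)"

lemma abs_sum_nonneg: "abs_sum A \<ge> 0"
  unfolding abs_sum_def by (simp add: sum_nonneg)

text \<open>The entrywise sum \<open>abs_sum A\<close> is cruder than an operator norm, but it
  controls each row as well as the total over all rows. The values \<open>v j\<close> are left in an
  arbitrary normed space because the bound is applied both to vectors \<open>f (g $ j)\<close> and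
  to real numbers \<open>\<rho> j * u j\<close>.\<close>

lemma sum_norm_matrix_le:
  fixes v :: "'s::finite \<Rightarrow> 'a::real_normed_vector"
  assumes "\<And>j. norm (v j) \<le> m"
  shows "(\<Sum>i\<in>UNIV. norm (h *\<^sub>R (\<Sum>j\<in>UNIV. (A $ i $ j) *\<^sub>R v j))) \<le> \<bar>h\<bar> * abs_sum A * m"
proof -
  have "(\<Sum>i\<in>UNIV. norm (h *\<^sub>R (\<Sum>j\<in>UNIV. (A $ i $ j) *\<^sub>R v j)))
      \<le> (\<Sum>i\<in>UNIV. \<bar>h\<bar> * ((\<Sum>j\<in>UNIV. \<bar>A $ i $ j\<bar>) * m))"
    by (intro sum_mono) (simp add: assms norm_sum_scaleR_le mult_left_mono)
  also have "\<dots> = \<bar>h\<bar> * abs_sum A * m"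
    unfolding abs_sum_def by (simp add: sum_distrib_left sum_distrib_right mult.assoc)
  finally show ?thesis .
qed

lemma norm_matrix_row_le:
  fixes v :: "'s::finite \<Rightarrow> 'a::real_normed_vector"
  assumes "\<And>j. norm (v j) \<le> m"
  shows "norm (h *\<^sub>R (\<Sum>j\<in>UNIV. (A $ i $ j) *\<^sub>R v j)) \<le> \<bar>h\<bar> * abs_sum A * m"
  by (rule order_trans[OF member_le_sum sum_norm_matrix_le[OF assms]]) auto

text \<open>Let m be the sum of all \<open>\<bar>u i\<bar>\<close>. Adding up the equations gives m
  \<le> q m with q = \<open>\<bar>h\<bar> * abs_sum A * P\<close> < 1, which forces m = 0.\<close>

lemma small_homogeneous_system_trivial:
  fixes A :: "real ^ 's ^ 's" and u \<rho> :: "'s \<Rightarrow> real"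
  assumes eq: "\<And>i. u i = h * (\<Sum>j\<in>UNIV. A $ i $ j * (\<rho> j * u j))"
    and \<rho>: "\<And>j. \<bar>\<rho> j\<bar> \<le> P" and small: "\<bar>h\<bar> * abs_sum A * P < 1"
  shows "u i = 0"
proof -
  define m where "m = (\<Sum>i\<in>UNIV. \<bar>u i\<bar>)"
  have um: "\<bar>u j\<bar> \<le> m" for j
    unfolding m_def by (rule member_le_sum) auto
  have "norm (\<rho> j * u j) \<le> P * m" for j
    using mult_mono[OF \<rho> um, of j j] \<rho>[of j] by (auto simp: abs_mult)
  from sum_norm_matrix_le[where v = "\<lambda>j. \<rho> j * u j", OF this, of h A]
  have "m \<le> \<bar>h\<bar> * abs_sum A * P * m"
    unfolding m_def by (simp flip: eq add: mult.assoc)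
  moreover have "0 \<le> m" using um[of i] by linarith
  ultimately have "m = 0"
    using small by (cases "m = 0") auto
  then show ?thesis using um[of i] by simp
qed

section \<open>Location, existence and uniqueness of the stages\<close>

lemma closed_Collect_all_nth_mem:
  assumes "closed S"
  shows "closed {g :: 'a::topological_space ^ 's. \<forall>i. g $ i \<in> S}"
proof -
  have "closed (\<Inter>i. (\<lambda>g :: 'a ^ 's. g $ i) -` S)"
    by (intro closed_INT ballI closed_vimage assms continuous_intros)
  then show ?thesis by (simp add: vimage_def Collect_all_eq)
qed

lemma rk_stage_near:
  assumes "rk_stage_equations A f h x g" "\<And>j. norm (f (g $ j)) \<le> M"
  shows "norm (g $ i - x) \<le> \<bar>h\<bar> * abs_sum A * M"
proof -
  have "g $ i - x = h *\<^sub>R (\<Sum>j\<in>UNIV. (A $ i $ j) *\<^sub>R f (g $ j))"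
    using assms(1) unfolding rk_stage_equations_def by (metis add_diff_cancel_left')
  then show ?thesis
    using norm_matrix_row_le[of "\<lambda>j. f (g $ j)", OF assms(2)] by metis
qed

lemma rk_stages_unique_exist:
  fixes A :: "real ^ 's ^ 's" and x :: "real ^ 'n"
  assumes "\<delta> > 0" "K \<ge> 0"
    and bound: "\<And>y. y \<in> cball x \<delta> \<Longrightarrow> norm (f y) \<le> M"
    and lip: "\<And>y z. y \<in> cball x \<delta> \<Longrightarrow> z \<in> cball x \<delta> \<Longrightarrow> norm (f y - f z) \<le> K * norm (y - z)"
    and h_bound: "\<bar>h\<bar> * abs_sum A * M < \<delta>" and h_lip: "\<bar>h\<bar> * abs_sum A * K < 1"
  shows "\<exists>!g. rk_stage_equations A f h x g \<and> (\<forall>i. g $ i \<in> ball x \<delta>)"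
proof -
  define S where "S = {g :: real ^ 'n ^ 's. \<forall>i. g $ i \<in> cball x \<delta>}"
  define T where "T g = (\<chi> i. x + h *\<^sub>R (\<Sum>j\<in>UNIV. (A $ i $ j) *\<^sub>R f (g $ j)))" for g :: "real ^ 'n ^ 's"
  have T_fix: "T g = g \<longleftrightarrow> rk_stage_equations A f h x g" for g
    unfolding T_def rk_stage_equations_def vec_eq_iff by auto
  \<comment> \<open>Completeness requires closed balls in \<open>S\<close>, while uniqueness is
    claimed in the open ball. As \<open>h_bound\<close> is strict, \<open>T\<close> sends
    \<open>S\<close> into the open balls, so a fixed point in \<open>S\<close> has all its
    components there.\<close>
  have T_ball: "T g $ i \<in> ball x \<delta>" if "g \<in> S" for g i
  proof -
    have "norm (T g $ i - x) \<le> \<bar>h\<bar> * abs_sum A * M"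
      using that by (simp add: T_def S_def bound norm_matrix_row_le del: norm_scaleR)
    also note h_bound
    finally show ?thesis by (simp add: dist_norm norm_minus_commute)
  qed
  have contraction: "dist (T g) (T g') \<le> \<bar>h\<bar> * abs_sum A * K * dist g g'"
    if "g \<in> S" "g' \<in> S" for g g'
  proof -
    have le: "norm (f (g $ j) - f (g' $ j)) \<le> K * norm (g - g')" for j
    proof -
      have "norm (f (g $ j) - f (g' $ j)) \<le> K * norm (g $ j - g' $ j)"
        using that by (intro lip) (auto simp: S_def)
      also have "\<dots> \<le> K * norm (g - g')"
        using Finite_Cartesian_Product.norm_nth_le[of "g - g'" j] \<open>K \<ge> 0\<close> by (simp add: mult_left_mono)
      finally show ?thesis .
    qed
    \<comment> \<open>The Euclidean norm on stage vectors is replaced by the larger sum of component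
      norms, to which the \<open>abs_sum\<close> bound applies.\<close>
    have "norm (T g - T g') \<le> (\<Sum>i\<in>UNIV. norm ((T g - T g') $ i))"
      by (simp add: norm_vec_def L2_set_le_sum)
    also have "\<dots> = (\<Sum>i\<in>UNIV. norm (h *\<^sub>R (\<Sum>j\<in>UNIV. (A $ i $ j) *\<^sub>R (f (g $ j) - f (g' $ j)))))"
      by (simp add: T_def scaleR_diff_right sum_subtractf)
    also have "\<dots> \<le> \<bar>h\<bar> * abs_sum A * (K * norm (g - g'))"
      by (rule sum_norm_matrix_le) (rule le)
    finally show ?thesis by (simp add: dist_norm mult.assoc)
  qed
  have "\<exists>!g\<in>S. T g = g"
  proof (rule Banach_fix)
    show "complete S"
      unfolding S_def complete_eq_closed by (rule closed_Collect_all_nth_mem) simp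
    have "(\<chi> i. x) \<in> S" using \<open>\<delta> > 0\<close> by (simp add: S_def)
    then show "S \<noteq> {}" by blast
    show "0 \<le> \<bar>h\<bar> * abs_sum A * K"
      using \<open>K \<ge> 0\<close> abs_sum_nonneg by (metis abs_ge_zero mult_nonneg_nonneg)
    show "T ` S \<subseteq> S"
      using T_ball by (simp add: S_def image_subset_iff less_imp_le)
  qed (use h_lip contraction in auto)
  moreover have "rk_stage_equations A f h x g \<and> (\<forall>i. g $ i \<in> ball x \<delta>) \<longleftrightarrow> g \<in> S \<and> T g = g" for g
    using T_ball[of g] T_fix[of g] by (auto simp: S_def intro: less_imp_le)
  ultimately show ?thesis by simp
qed

section \<open>The invariant hyperplane\<close>

lemma first_integral_affine_quotient:
  assumes "first_integral_on U f (\<lambda>x. (a \<bullet> x + c) / (d \<bullet> x + e))" "y \<in> U" "d \<bullet> y + e \<noteq> 0"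
  shows "(d \<bullet> y + e) * (a \<bullet> f y) = (a \<bullet> y + c) * (d \<bullet> f y)"
proof -
  let ?r = "d \<bullet> y + e" and ?q = "a \<bullet> y + c"
  obtain D where D: "GDERIV (\<lambda>x. (a \<bullet> x + c) / (d \<bullet> x + e)) y :> D" and "f y \<bullet> D = 0"
    using assms(1,2) unfolding first_integral_on_def by blast
  have "((\<lambda>x. (a \<bullet> x + c) / (d \<bullet> x + e)) has_derivative
      (\<lambda>k. ((a \<bullet> k) * ?r - ?q * (d \<bullet> k)) / (?r * ?r))) (at y)"
    using assms(3) by (auto intro!: derivative_eq_intros)
  \<comment> \<open>The gradient \<open>D\<close> is only known to exist. Uniqueness of the
    derivative identifies it with the quotient rule, which is then evaluated in the direction
    \<open>f y\<close>.\<close>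
  with D have "(\<lambda>k. k \<bullet> D) = (\<lambda>k. ((a \<bullet> k) * ?r - ?q * (d \<bullet> k)) / (?r * ?r))"
    unfolding gderiv_def by (rule has_derivative_unique)
  then have "f y \<bullet> D = ((a \<bullet> f y) * ?r - ?q * (d \<bullet> f y)) / (?r * ?r)"
    by (rule fun_cong)
  with \<open>f y \<bullet> D = 0\<close> assms(3) show ?thesis
    by (simp add: mult.commute)
qed

lemma rk_map_preserves_invariant_hyperplane:
  fixes A :: "real ^ 's ^ 's" and \<rho> :: "real ^ 'n \<Rightarrow> real"
  assumes stages: "rk_stage_equations A f h x (G h)"
    and inv: "\<And>j. l \<bullet> f (G h $ j) = \<rho> (G h $ j) * (l \<bullet> (G h $ j) + m)"
    and \<rho>: "\<And>j. \<bar>\<rho> (G h $ j)\<bar> \<le> P" and small: "\<bar>h\<bar> * abs_sum A * P < 1"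
    and x: "l \<bullet> x + m = 0"
  shows "l \<bullet> rk_map b f G h x + m = 0"
proof -
  have "l \<bullet> (G h $ i) + m = 0" for i
  proof (rule small_homogeneous_system_trivial[OF _ \<rho> small])
    fix i
    have "G h $ i = x + h *\<^sub>R (\<Sum>j\<in>UNIV. (A $ i $ j) *\<^sub>R f (G h $ j))"
      using stages unfolding rk_stage_equations_def by blast
    then have "l \<bullet> (G h $ i) + m = (l \<bullet> x + m) + h * (\<Sum>j\<in>UNIV. A $ i $ j * (l \<bullet> f (G h $ j)))"
      by (simp add: inner_add_right inner_sum_right)
    then show "l \<bullet> (G h $ i) + m
        = h * (\<Sum>j\<in>UNIV. A $ i $ j * (\<rho> (G h $ j) * (l \<bullet> (G h $ j) + m)))"
      by (simp add: x inv)
  qed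
  \<comment> \<open>With all stages on the hyperplane, \<open>inv\<close> makes the slopes
    orthogonal to its normal \<open>l\<close>, so the update starting at \<open>x\<close> stays on
    it.\<close>
  then have "l \<bullet> f (G h $ j) = 0" for j
    by (simp add: inv)
  then show ?thesis
    using x by (simp add: rk_map_def inner_add_right inner_sum_right)
qed

theorem corollary1:
  fixes A :: "real ^ 's ^ 's"
    and b :: "real ^ 's"
    and f :: "real ^ 'n \<Rightarrow> real ^ 'n"
    and Q R H :: "real ^ 'n \<Rightarrow> real"
    and U :: "(real ^ 'n) set"
  assumes "affine_function Q" and "affine_function R"
    and "R \<noteq> (\<lambda>x. 0)"
    and H_def: "H = (\<lambda>x. Q x / R x)"
    and "open U"
    and "\<And>x. x \<in> U \<Longrightarrow> R x \<noteq> 0"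
    and "continuously_differentiable_on f U"
    and "first_integral_on U f H"
  shows "\<forall>x\<in>U. \<exists>h0>0. \<exists>G. rk_local_stages A f x h0 G \<and>
    (\<forall>h. \<bar>h\<bar> < h0 \<longrightarrow>
      (\<forall>i. G h $ i \<in> U) \<and> rk_map b f G h x \<in> U \<and> H (rk_map b f G h x) = H x)"
proof
  fix x assume "x \<in> U"
  obtain a c where Q: "Q = (\<lambda>x. a \<bullet> x + c)"
    using assms(1) unfolding affine_function_def by blast
  obtain d e where R: "R = (\<lambda>x. d \<bullet> x + e)"
    using assms(2) unfolding affine_function_def by blast
  obtain \<delta> where "\<delta> > 0" and \<delta>: "cball x \<delta> \<subseteq> U"
    using \<open>open U\<close> \<open>x \<in> U\<close> open_contains_cball by blast
  \<comment> \<open>This factor does not depend on the level \<open>H x\<close>; its continuity on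
    the closed ball provides the bound \<open>P\<close> below.\<close>
  define \<rho> where "\<rho> y = (d \<bullet> f y) / R y" for y
  have C1: "continuously_differentiable_on f (cball x \<delta>)"
    using assms(7) \<delta> by (rule continuously_differentiable_on_subset)
  note cont = continuously_differentiable_on_imp_continuous_on[OF C1]
  have cont_\<rho>: "continuous_on (cball x \<delta>) \<rho>"
    using \<delta> assms(6) unfolding \<rho>_def R by (intro continuous_intros cont) auto
  obtain K where "K > 0" and K: "\<And>y z. y \<in> cball x \<delta> \<Longrightarrow> z \<in> cball x \<delta> \<Longrightarrow>
      norm (f y - f z) \<le> K * norm (y - z)"
    using continuously_differentiable_on_lipschitz[OF C1 compact_cball convex_cball] by blast
  obtain M where "M > 0" and M: "\<And>y. y \<in> cball x \<delta> \<Longrightarrow> norm (f y) \<le> M"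
    using compact_continuous_on_norm_bound[OF compact_cball cont] by blast
  obtain P where "P > 0" and P: "\<And>y. y \<in> cball x \<delta> \<Longrightarrow> norm (\<rho> y) \<le> P"
    using compact_continuous_on_norm_bound[OF compact_cball cont_\<rho>] by blast
  define \<beta> where "\<beta> = (\<Sum>j\<in>UNIV. \<bar>b $ j\<bar>)"
  \<comment> \<open>In order: the stage map preserves the ball, it contracts, the homogeneous system
    has only the zero solution, and the image of \<open>x\<close> stays in the ball. The filter
    \<open>nhds 0\<close> includes h = 0, which \<open>rk_local_stages\<close> also covers.\<close>
  have "\<forall>\<^sub>F h in nhds 0. \<bar>h\<bar> * abs_sum A * M < \<delta> \<and> \<bar>h\<bar> * abs_sum A * K < 1 \<and>
      \<bar>h\<bar> * abs_sum A * P < 1 \<and> \<bar>h\<bar> * \<beta> * M < \<delta>"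
  proof -
    have "\<forall>\<^sub>F h in nhds (0::real). \<bar>h\<bar> * p * q < r" if "r > 0" for p q r :: real
    proof (rule order_tendstoD(2)[OF _ that])
      show "((\<lambda>h. \<bar>h\<bar> * p * q) \<longlongrightarrow> 0) (nhds (0::real))"
        by (auto intro!: tendsto_eq_intros filterlim_ident)
    qed
    then show ?thesis using \<open>\<delta> > 0\<close> by (intro eventually_conj) auto
  qed
  then obtain h0 where "h0 > 0" and h0: "\<And>h. \<bar>h\<bar> < h0 \<Longrightarrow>
      \<bar>h\<bar> * abs_sum A * M < \<delta> \<and> \<bar>h\<bar> * abs_sum A * K < 1 \<and>
      \<bar>h\<bar> * abs_sum A * P < 1 \<and> \<bar>h\<bar> * \<beta> * M < \<delta>"
    unfolding eventually_nhds_metric dist_real_def by auto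
  define G where "G h = (THE g. rk_stage_equations A f h x g \<and> (\<forall>i. g $ i \<in> ball x \<delta>))" for h
  have ex1: "\<exists>!g. rk_stage_equations A f h x g \<and> (\<forall>i. g $ i \<in> ball x \<delta>)" if "\<bar>h\<bar> < h0" for h
    using h0[OF that] \<open>K > 0\<close> by (intro rk_stages_unique_exist[OF \<open>\<delta> > 0\<close> _ M K]) auto
  have G: "rk_stage_equations A f h x (G h)" "G h $ i \<in> ball x \<delta>" if "\<bar>h\<bar> < h0" for h i
    using theI'[OF ex1[OF that]] unfolding G_def by auto
  have G_cball: "G h $ i \<in> cball x \<delta>" if "\<bar>h\<bar> < h0" for h i
    using G(2)[OF that, of i] by simp
  have "((\<lambda>h. G h $ i) \<longlongrightarrow> x) (at 0)" for i
  proof (rule LIM_zero_cancel, rule Lim_null_comparison)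
    have "\<forall>\<^sub>F h in at 0. \<bar>h\<bar> < h0"
      using \<open>h0 > 0\<close> unfolding eventually_at dist_real_def by auto
    then show "\<forall>\<^sub>F h in at 0. norm (G h $ i - x) \<le> \<bar>h\<bar> * abs_sum A * M"
      by eventually_elim (use rk_stage_near G(1) M G_cball in blast)
    show "((\<lambda>h. \<bar>h\<bar> * abs_sum A * M) \<longlongrightarrow> 0) (at 0)"
      by (auto intro!: tendsto_eq_intros)
  qed
  moreover have "\<forall>h. \<bar>h\<bar> < h0 \<longrightarrow>
      (\<forall>g. rk_stage_equations A f h x g \<and> (\<forall>i. g $ i \<in> ball x \<delta>) \<longleftrightarrow> g = G h)"
    using ex1 G by blast
  ultimately have local: "rk_local_stages A f x h0 G"
    unfolding rk_local_stages_def using \<open>\<delta> > 0\<close> by blast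
  have "(\<forall>i. G h $ i \<in> U) \<and> rk_map b f G h x \<in> U \<and> H (rk_map b f G h x) = H x"
    if h: "\<bar>h\<bar> < h0" for h
  proof -
    have stagesU: "G h $ i \<in> U" for i
      using \<delta> G_cball[OF h] by blast
    have "norm (rk_map b f G h x - x) \<le> \<bar>h\<bar> * (\<beta> * M)"
      unfolding rk_map_def \<beta>_def using M[OF G_cball[OF h]]
      by (simp add: norm_sum_scaleR_le mult_left_mono)
    also have "\<dots> < \<delta>" using h0[OF h] by (simp add: mult.assoc)
    finally have mapU: "rk_map b f G h x \<in> U"
      using \<delta> by (auto simp: dist_norm norm_minus_commute subset_iff)
    define l where "l = a - H x *\<^sub>R d"
    define m where "m = c - H x * e"
    have L: "l \<bullet> y + m = Q y - H x * R y" for y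
      unfolding l_def m_def Q R by (simp add: inner_diff_left algebra_simps)
    \<comment> \<open>Replacing \<open>R y * (a \<bullet> f y)\<close> by
      \<open>Q y * (d \<bullet> f y)\<close> in \<open>R y * (l \<bullet> f y)\<close> leaves
      \<open>(Q y - H x * R y) * (d \<bullet> f y)\<close>; dividing by \<open>R y\<close> produces
      \<open>\<rho> y\<close>.\<close>
    have inv: "l \<bullet> f y = \<rho> y * (l \<bullet> y + m)" if "y \<in> U" for y
    proof -
      have "R y * (a \<bullet> f y) = Q y * (d \<bullet> f y)"
        using first_integral_affine_quotient[of U f a c d e y] assms(6,8) that
        unfolding H_def Q R by blast
      then show ?thesis
        using assms(6)[OF that] unfolding L \<rho>_def
        by (simp add: l_def inner_diff_left field_simps)
    qed
    have "l \<bullet> rk_map b f G h x + m = 0"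
    proof (rule rk_map_preserves_invariant_hyperplane[where \<rho> = \<rho> and P = P and A = A])
      show "l \<bullet> x + m = 0"
        unfolding L H_def using assms(6)[OF \<open>x \<in> U\<close>] by simp
    qed (use G(1)[OF h] h0[OF h] P[OF G_cball[OF h]] inv stagesU in auto)
    \<comment> \<open>Returning from the hyperplane to \<open>H\<close> divides by \<open>R\<close>
      at the new point, which is nonzero by \<open>mapU\<close>.\<close>
    then have "H (rk_map b f G h x) = H x"
      using assms(6)[OF mapU] unfolding L by (simp add: H_def)
    with mapU stagesU show ?thesis by blast
  qed
  with local \<open>h0 > 0\<close> show "\<exists>h0>0. \<exists>G. rk_local_stages A f x h0 G \<and>
    (\<forall>h. \<bar>h\<bar> < h0 \<longrightarrow>
      (\<forall>i. G h $ i \<in> U) \<and> rk_map b f G h x \<in> U \<and> H (rk_map b f G h x) = H x)"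
    by blast
qed

end
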